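(* Let $d\ge 1$ and let $X^{d-1}$ be an $n$-vertex polytopal $(d-1)$-sphere. Then there exists a sequence $X^{d-1}\subset X^{d}\subset\cdots\subset X^{n-2}=S^{n-2}_n$ of $n$-vertex polytopal spheres, of dimensions $d-1,d,\dots,n-2$ respectively, each a subcomplex of the next, where $S^{n-2}_n$ is the standard $(n-2)$-sphere on the $n$ vertices of $X^{d-1}$.
   Context: Simplicial complexes are finite and abstract; isomorphic complexes are identified. An $n$-vertex complex is one with exactly $n$ vertices. A polytopal $(k-1)$-sphere is a simplicial complex isomorphic to the boundary complex of a simplicial $k$-polytope. The standard $k$-sphere $S^k_{k+2}$ is the boundary complex of a $(k+1)$-simplex (so it has $k+2$ vertices). *)

theory Defs
  imports "HOL-Analysis.Analysis" "HOL-Analysis.Finite_Function_Topology"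
begin

section \<open>Finite abstract simplicial complexes\<close>

text \<open>
  A complex is the set of all its faces, the empty face included. Its vertex set is the
  union of its faces, so it is an \<open>n\<close>-vertex complex iff \<open>card (\<Union>K) = n\<close>, and for complexes
  \<open>L\<close> and \<open>K\<close>, \<open>L\<close> is a subcomplex of \<open>K\<close> iff \<open>L \<subseteq> K\<close>.
\<close>

definition simplicial_complex :: "'v set set \<Rightarrow> bool" where
  "simplicial_complex K \<longleftrightarrow>
     finite K \<and> (\<forall>F\<in>K. finite F) \<and> {} \<in> K \<and> (\<forall>F\<in>K. \<forall>G. G \<subseteq> F \<longrightarrow> G \<in> K)"

definition isomorphic_complexes :: "'v set set \<Rightarrow> 'w set set \<Rightarrow> bool" where
  "isomorphic_complexes K L \<longleftrightarrow> (\<exists>f. bij_betw f (\<Union>K) (\<Union>L) \<and> L = image f ` K)"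

section \<open>Simplicial polytopes\<close>

text \<open>
  Polytopes of every dimension have to live in a single type, so the ambient space used below
  is the space of finitely supported real sequences, which contains a copy of every Euclidean
  space. The library's \<^const>\<open>aff_dim\<close> and \<^const>\<open>simplex\<close> are restricted to Euclidean spaces;
  the next two definitions are their defining formulas over an arbitrary real vector space,
  for dimensions \<open>k \<ge> 0\<close> (a set of cardinality \<open>k + 1\<close> is finite).
\<close>

type_synonym real_inf = "(nat, real) poly_mapping"

definition has_aff_dim :: "'a::real_vector set \<Rightarrow> nat \<Rightarrow> bool" where
  "has_aff_dim S k \<longleftrightarrow>
     (\<exists>B. affine hull B = affine hull S \<and> \<not> affine_dependent B \<and> card B = k + 1)"

definition k_simplex :: "nat \<Rightarrow> 'a::real_vector set \<Rightarrow> bool" where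
  "k_simplex k S \<longleftrightarrow> (\<exists>C. \<not> affine_dependent C \<and> card C = k + 1 \<and> S = convex hull C)"

definition simplicial_polytope :: "'a::real_vector set \<Rightarrow> bool" where
  "simplicial_polytope P \<longleftrightarrow>
     polytope P \<and> (\<forall>F. F face_of P \<and> F \<noteq> {} \<and> F \<noteq> P \<longrightarrow> (\<exists>k. k_simplex k F))"

definition boundary_complex :: "'a::real_vector set \<Rightarrow> 'a set set" where
  "boundary_complex P = {{x. x extreme_point_of F} | F. F face_of P \<and> F \<noteq> P}"

section \<open>Polytopal spheres and standard spheres\<close>

definition polytopal_sphere :: "nat \<Rightarrow> 'v set set \<Rightarrow> bool" where
  "polytopal_sphere k K \<longleftrightarrow>
     simplicial_complex K \<and>
     (\<exists>P :: real_inf set. simplicial_polytope P \<and> has_aff_dim P (k + 1) \<and>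
        isomorphic_complexes K (boundary_complex P))"

definition standard_sphere :: "nat \<Rightarrow> 'v set set \<Rightarrow> bool" where
  "standard_sphere k K \<longleftrightarrow>
     simplicial_complex K \<and>
     (\<exists>S :: real_inf set. k_simplex (k + 1) S \<and> isomorphic_complexes K (boundary_complex S))"

section \<open>Agreement with the Euclidean notions\<close>

lemma has_aff_dim_iff_aff_dim:
  fixes S :: "'a::euclidean_space set"
  shows "has_aff_dim S k \<longleftrightarrow> aff_dim S = int k"
proof
  assume "has_aff_dim S k"
  then obtain B where "affine hull B = affine hull S" "\<not> affine_dependent B" "card B = k + 1"
    unfolding has_aff_dim_def by blast
  then show "aff_dim S = int k"
    using aff_dim_unique[of B S] by simp
next
  assume k: "aff_dim S = int k"
  obtain B where B: "affine hull B = affine hull S" "\<not> affine_dependent B"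
    "int (card B) = aff_dim S + 1"
    using aff_dim_basis_exists[of S] by blast
  have "card B = k + 1"
    using B(3) k by linarith
  with B(1,2) show "has_aff_dim S k"
    unfolding has_aff_dim_def by blast
qed

lemma k_simplex_iff_simplex:
  fixes S :: "'a::euclidean_space set"
  shows "k_simplex k S \<longleftrightarrow> int k simplex S"
proof -
  have "int (card C) = int k + 1 \<longleftrightarrow> card C = k + 1" for C :: "'a set"
    by linarith
  then show ?thesis
    by (simp add: k_simplex_def simplex_def)
qed

text \<open>
  The choice of ambient space loses nothing: simplicial polytopes in any Euclidean space give
  polytopal spheres.
\<close>

lemma exists_linear_inj_real_inf:
  "\<exists>f :: 'a::euclidean_space \<Rightarrow> real_inf. linear f \<and> inj f"
proof -
  obtain e :: "'a \<Rightarrow> nat" where e: "inj_on e Basis"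
    using finite_imp_inj_to_nat_seg[OF finite_Basis] by metis
  define f :: "'a \<Rightarrow> real_inf"
    where "f x = (\<Sum>b\<in>Basis. (x \<bullet> b) *\<^sub>R Poly_Mapping.single (e b) 1)" for x
  have lin: "linear f"
    by (rule linearI)
      (simp_all add: f_def inner_add_left scaleR_add_left sum.distrib scaleR_sum_right)
  have lk: "Poly_Mapping.lookup (r *\<^sub>R p) i = r * Poly_Mapping.lookup p i"
    for r i and p :: real_inf
  proof -
    have "finite {i. r * Poly_Mapping.lookup p i \<noteq> 0}"
      by (rule finite_subset[OF _ finite_keys[of p]]) (auto simp: in_keys_iff)
    then show ?thesis by (simp add: scaleR_poly_mapping_def)
  qed
  have "x \<bullet> c = Poly_Mapping.lookup (f x) (e c)" if c: "c \<in> Basis" for x c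
  proof -
    have "Poly_Mapping.lookup (f x) (e c) = (\<Sum>b\<in>Basis. if b = c then x \<bullet> b else 0)"
      unfolding f_def lookup_sum lk lookup_single
      by (rule sum.cong) (use e c in \<open>auto simp: when_def inj_on_def\<close>)
    then show ?thesis using c by simp
  qed
  then have "inj f"
    by (metis euclidean_eqI injI)
  with lin show ?thesis by blast
qed

lemma affine_linear_image:
  fixes f :: "'a::real_vector \<Rightarrow> 'b::real_vector"
  assumes "linear f" "affine T"
  shows "affine (f ` T)"
  unfolding affine_def
proof (intro ballI allI impI)
  fix x' y' and u v :: real
  assume xy': "x' \<in> f ` T" "y' \<in> f ` T" and uv: "u + v = 1"
  obtain x y where xy: "x \<in> T" "y \<in> T" "x' = f x" "y' = f y"
    using xy' by blast
  have "u *\<^sub>R x + v *\<^sub>R y \<in> T"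
    using assms(2) xy(1,2) uv by (rule mem_affine)
  moreover have "u *\<^sub>R x' + v *\<^sub>R y' = f (u *\<^sub>R x + v *\<^sub>R y)"
    using assms(1) xy by (simp add: linear_add linear_scale)
  ultimately show "u *\<^sub>R x' + v *\<^sub>R y' \<in> f ` T"
    by simp
qed

lemma affine_hull_linear_image:
  fixes f :: "'a::real_vector \<Rightarrow> 'b::real_vector"
  assumes "linear f"
  shows "affine hull (f ` S) = f ` (affine hull S)"
proof (rule subset_antisym)
  have "affine (f ` (affine hull S))"
    using assms affine_affine_hull by (rule affine_linear_image)
  then show "affine hull (f ` S) \<subseteq> f ` (affine hull S)"
    by (simp add: hull_minimal hull_subset image_mono)
next
  have "affine (f -` (affine hull (f ` S)))"
    using affine_affine_hull[of "f ` S"] assms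
    by (auto simp: affine_def linear_add linear_scale)
  moreover have "S \<subseteq> f -` (affine hull (f ` S))"
    by (auto intro: hull_inc)
  ultimately show "f ` (affine hull S) \<subseteq> affine hull (f ` S)"
    by (metis hull_minimal image_subset_iff_subset_vimage)
qed

lemma affine_dependent_linear_image_iff:
  fixes f :: "'a::real_vector \<Rightarrow> 'b::real_vector"
  assumes "linear f" "inj f"
  shows "affine_dependent (f ` S) \<longleftrightarrow> affine_dependent S"
proof -
  have "f ` S - {f x} = f ` (S - {x})" for x
    using assms(2) by (auto simp: inj_def)
  then show ?thesis
    using assms by (simp add: affine_dependent_def affine_hull_linear_image inj_image_mem_iff)
qed

lemma card_image_inj: "inj f \<Longrightarrow> card (f ` S) = card S"
  by (meson card_image inj_on_subset subset_UNIV)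

lemma has_aff_dim_linear_image:
  assumes "linear f" "inj f" "has_aff_dim S k"
  shows "has_aff_dim (f ` S) k"
proof -
  obtain B where B: "affine hull B = affine hull S" "\<not> affine_dependent B" "card B = k + 1"
    using assms(3) unfolding has_aff_dim_def by blast
  then have "affine hull (f ` B) = affine hull (f ` S)" "\<not> affine_dependent (f ` B)"
    "card (f ` B) = k + 1"
    using assms(1,2)
    by (simp_all add: affine_hull_linear_image affine_dependent_linear_image_iff card_image_inj)
  then show ?thesis
    unfolding has_aff_dim_def by blast
qed

lemma k_simplex_linear_image:
  assumes "linear f" "inj f" "k_simplex k S"
  shows "k_simplex k (f ` S)"
proof -
  obtain C where C: "\<not> affine_dependent C" "card C = k + 1" "S = convex hull C"
    using assms(3) unfolding k_simplex_def by blast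
  then have "\<not> affine_dependent (f ` C)" "card (f ` C) = k + 1" "f ` S = convex hull (f ` C)"
    using assms(1,2)
    by (simp_all add: convex_hull_linear_image affine_dependent_linear_image_iff card_image_inj)
  then show ?thesis
    unfolding k_simplex_def by blast
qed

lemma face_of_linear_image_cases:
  assumes "linear f" "inj f"
  shows "F face_of f ` P \<longleftrightarrow> (\<exists>G. G face_of P \<and> F = f ` G)"
  using faces_of_linear_image[OF assms, of P] by blast

lemma simplicial_polytope_linear_image:
  assumes "linear f" "inj f" "simplicial_polytope P"
  shows "simplicial_polytope (f ` P)"
proof -
  have "polytope (f ` P)"
    using assms(1,3) unfolding simplicial_polytope_def polytope_def
    by (metis convex_hull_linear_image finite_imageI)
  moreover have "\<exists>k. k_simplex k F"
    if F: "F face_of f ` P" "F \<noteq> {}" "F \<noteq> f ` P" for F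
  proof -
    obtain G where "G face_of P" "F = f ` G"
      using F(1) face_of_linear_image_cases[OF assms(1,2)] by blast
    with F show ?thesis
      using assms k_simplex_linear_image unfolding simplicial_polytope_def by blast
  qed
  ultimately show ?thesis
    unfolding simplicial_polytope_def by blast
qed

lemma boundary_complex_linear_image:
  assumes "linear f" "inj f"
  shows "boundary_complex (f ` P) = image f ` boundary_complex P"
proof -
  have ext: "{x. x extreme_point_of f ` G} = f ` {x. x extreme_point_of G}" for G
  proof -
    have "f y extreme_point_of f ` G \<longleftrightarrow> y extreme_point_of G" for y
      using face_of_linear_image[OF assms, of "{y}" G] by (simp add: face_of_singleton)
    moreover have "x \<in> range f" if "x extreme_point_of f ` G" for x
      using that by (auto simp: extreme_point_of_def)
    ultimately have "x extreme_point_of f ` G \<longleftrightarrow> (\<exists>y. y extreme_point_of G \<and> x = f y)" for x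
      by (metis rangeE)
    then show ?thesis
      by (simp add: set_eq_iff image_iff)
  qed
  have "{F. F face_of f ` P \<and> F \<noteq> f ` P} = image f ` {G. G face_of P \<and> G \<noteq> P}"
    unfolding face_of_linear_image_cases[OF assms] using assms(2)
    by (simp add: set_eq_iff[of _ "_ ` {G. G face_of P \<and> G \<noteq> P}"] image_iff)
       (metis inj_image_eq_iff)
  then show ?thesis
    by (simp add: boundary_complex_def setcompr_eq_image image_image ext)
qed

lemma polytopal_sphere_if_euclidean:
  fixes P :: "'a::euclidean_space set"
  assumes "simplicial_complex K" "simplicial_polytope P" "aff_dim P = int k + 1"
    and "isomorphic_complexes K (boundary_complex P)"
  shows "polytopal_sphere k K"
proof -
  obtain f :: "'a \<Rightarrow> real_inf" where f: "linear f" "inj f"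
    using exists_linear_inj_real_inf by blast
  have dim: "has_aff_dim (f ` P) (k + 1)"
    using assms(3) by (intro has_aff_dim_linear_image f) (simp add: has_aff_dim_iff_aff_dim)
  obtain g where g: "bij_betw g (\<Union>K) (\<Union>(boundary_complex P))" "boundary_complex P = image g ` K"
    using assms(4) unfolding isomorphic_complexes_def by blast
  have "bij_betw (f \<circ> g) (\<Union>K) (\<Union>(boundary_complex (f ` P)))"
    unfolding boundary_complex_linear_image[OF f] image_Union[symmetric]
    using g(1) f(2) by (metis bij_betw_imageI bij_betw_trans inj_on_subset subset_UNIV)
  moreover have "boundary_complex (f ` P) = image (f \<circ> g) ` K"
    unfolding boundary_complex_linear_image[OF f] g(2) by (simp add: image_image image_comp)
  ultimately have "isomorphic_complexes K (boundary_complex (f ` P))"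
    unfolding isomorphic_complexes_def by blast
  with assms(1,2) dim f show ?thesis
    unfolding polytopal_sphere_def using simplicial_polytope_linear_image by blast
qed

end

theory Submission
  imports Defs
begin

text \<open>
  Lift each vertex \<open>v\<close> of a simplicial polytope \<open>P\<close> to a height \<open>h v\<close> in a new direction \<open>e\<close>, and
  let \<open>Q\<close> be the convex hull of the lifted vertices. The preimage of a face of \<open>P\<close> under the
  projection \<open>Q \<rightarrow> P\<close> is a face of \<open>Q\<close>, so the boundary complex of \<open>P\<close> embeds in that of \<open>Q\<close>. If
  \<open>h\<close> is not affine on any affinely dependent set of vertices, then \<open>Q\<close> is again simplicial, and its
  dimension is one higher unless \<open>P\<close> is a simplex. Iterating until the polytope is a simplex
  gives the sequence.
\<close>

section \<open>Faces and dimension in real vector spaces\<close>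

text \<open>If a point \<open>v\<close> of \<open>S\<close> has positive weight in a convex
  representation of a point \<open>x\<close> of \<open>F\<close>, then \<open>x\<close> is
  \<open>v\<close> itself or lies strictly between \<open>v\<close> and the normalised combination
  \<open>y\<close> of the other points. Either way \<open>v\<close> lies in \<open>F\<close>, so all
  the weight sits on \<open>S \<inter> F\<close>.\<close>

lemma face_of_convex_hull_finite:
  fixes S :: "'a::real_vector set"
  assumes S: "finite S" and F: "F face_of convex hull S"
  shows "F = convex hull (S \<inter> F)"
proof
  show "convex hull (S \<inter> F) \<subseteq> F"
    using F by (simp add: face_of_imp_convex hull_minimal)
  show "F \<subseteq> convex hull (S \<inter> F)"
  proof
    fix x assume x: "x \<in> F"
    then have "x \<in> convex hull S"
      using F face_of_imp_subset by blast
    then obtain u where u: "\<And>v. v \<in> S \<Longrightarrow> 0 \<le> u v" "sum u S = 1" "(\<Sum>v\<in>S. u v *\<^sub>R v) = x"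
      using convex_hull_finite[OF S] by auto
    have mem: "v \<in> F" if v: "v \<in> S" "u v \<noteq> 0" for v
    proof (cases "u v = 1")
      case True
      have "sum u (S - {v}) = 0"
        using u(2) True S v by (simp add: sum.remove[of S v])
      then have "\<forall>w\<in>S - {v}. u w = 0"
        using u(1) S by (subst (asm) sum_nonneg_eq_0_iff) auto
      then have "(\<Sum>w\<in>S - {v}. u w *\<^sub>R w) = 0"
        by (simp add: sum.neutral)
      then have "x = v"
        using u(3) True S v by (simp add: sum.remove[of S v])
      then show ?thesis using x by simp
    next
      case False
      define r where "r = 1 - u v"
      have sr: "sum u (S - {v}) = r"
        using u(2) S v by (simp add: sum.remove[of S v] r_def)
      then have "r \<ge> 0"
        using u(1) by (metis DiffD1 sum_nonneg)
      then have r: "0 < r" "r < 1"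
        using False v u(1)[of v] by (auto simp: r_def)
      define y where "y = (\<Sum>w\<in>S - {v}. (u w / r) *\<^sub>R w)"
      have y: "y \<in> convex hull (S - {v})"
        using S u(1) r sr unfolding y_def convex_hull_finite[OF finite_Diff[OF S]]
        by (auto intro!: exI[of _ "\<lambda>w. u w / r"] simp: sum_divide_distrib[symmetric])
      then have yS: "y \<in> convex hull S"
        by (meson Diff_subset hull_mono subsetD)
      have "r *\<^sub>R y = (\<Sum>w\<in>S - {v}. u w *\<^sub>R w)"
        using r by (simp add: y_def scaleR_sum_right)
      then have xeq: "x = (1 - r) *\<^sub>R v + r *\<^sub>R y"
        using u(3) S v by (simp add: sum.remove[of S v] r_def)
      show ?thesis
      proof (cases "v = y")
        case True
        then show ?thesis using xeq x by (simp add: scaleR_left_distrib[symmetric])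
      next
        case False
        then have "x \<in> open_segment v y"
          using r xeq by (auto simp: in_segment)
        then show ?thesis
          using F x yS v hull_inc[of v S convex] unfolding face_of_def by blast
      qed
    qed
    have s: "sum u (S \<inter> F) = 1"
      using u(2) mem S by (subst sum.mono_neutral_left[of S]) auto
    have "(\<Sum>v\<in>S \<inter> F. u v *\<^sub>R v) = x"
      unfolding u(3)[symmetric] using mem S by (intro sum.mono_neutral_left) auto
    with s show "x \<in> convex hull (S \<inter> F)"
      using S u(1) by (auto simp: convex_hull_finite)
  qed
qed

text \<open>In a generating set of least cardinality no point lies in the hull of the others, since
  it could be dropped; such a point is extreme.\<close>

lemma polytope_eq_convex_hull_extreme_points:
  fixes P :: "'a::real_vector set"
  assumes "polytope P"
  shows "finite {x. x extreme_point_of P}" "P = convex hull {x. x extreme_point_of P}"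
proof -
  have ex: "\<exists>S. finite S \<and> P = convex hull S"
    using assms unfolding polytope_def .
  define S where "S = (ARG_MIN card S. finite S \<and> P = convex hull S)"
  have S: "finite S" "P = convex hull S"
    and min: "\<And>T. finite T \<Longrightarrow> P = convex hull T \<Longrightarrow> card S \<le> card T"
    using arg_min_nat_lemma[of "\<lambda>S. finite S \<and> P = convex hull S" _ card] ex
    unfolding S_def by blast+
  have "s extreme_point_of P" if s: "s \<in> S" for s
  proof -
    have "s \<notin> convex hull (S - {s})"
    proof
      assume "s \<in> convex hull (S - {s})"
      then have "P = convex hull (S - {s})"
        using S(2) s by (metis hull_redundant insert_Diff)
      then show False
        using min[of "S - {s}"] card_Diff1_less[of S s] S(1) s by simp
    qed
    then show ?thesis
      using extreme_point_of_convex_hull_insert[of "S - {s}" s] S s by (simp add: insert_absorb)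
  qed
  then have "{x. x extreme_point_of P} = S"
    using S(2) extreme_point_of_convex_hull by blast
  then show "finite {x. x extreme_point_of P}" "P = convex hull {x. x extreme_point_of P}"
    using S by simp_all
qed

section \<open>Faces of simplices and affine hulls of faces\<close>

lemma extreme_points_of_affine_independent:
  fixes C :: "'a::real_vector set"
  assumes "finite C" "\<not> affine_dependent C"
  shows "{x. x extreme_point_of convex hull C} = C"
proof
  show "C \<subseteq> {x. x extreme_point_of convex hull C}"
  proof clarify
    fix x assume x: "x \<in> C"
    then have "x \<notin> convex hull (C - {x})"
      using assms(2) convex_hull_subset_affine_hull unfolding affine_dependent_def by blast
    then show "x extreme_point_of convex hull C"
      using extreme_point_of_convex_hull_insert[of "C - {x}" x] assms(1) x
      by (simp add: insert_absorb)
  qed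
qed (use extreme_point_of_convex_hull in blast)

text \<open>A common point of the affine hulls of \<open>T\<close> and \<open>C - T\<close> would
  have two affine representations, whose difference \<open>c\<close> is a nontrivial dependency of
  \<open>C\<close>. Disjointness of these hulls yields the face through
  \<open>face_of_convex_hulls\<close>.\<close>

lemma face_of_affine_independent:
  fixes C :: "'a::real_vector set"
  assumes "finite C" "\<not> affine_dependent C" "T \<subseteq> C"
  shows "convex hull T face_of convex hull C"
proof -
  have fin: "finite T" "finite (C - T)"
    using assms by (auto intro: finite_subset)
  have "False" if x: "x \<in> affine hull T" "x \<in> affine hull (C - T)" for x
  proof -
    obtain u where u: "sum u T = 1" "(\<Sum>v\<in>T. u v *\<^sub>R v) = x"
      using x(1) affine_hull_finite[OF fin(1)] by auto
    obtain w where w: "sum w (C - T) = 1" "(\<Sum>v\<in>C - T. w v *\<^sub>R v) = x"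
      using x(2) affine_hull_finite[OF fin(2)] by auto
    define c where "c v = (if v \<in> T then u v else - w v)" for v
    have "sum c C = 0"
      using assms u w by (simp add: sum.subset_diff[of T C] c_def sum_negf)
    moreover have "(\<Sum>v\<in>C. c v *\<^sub>R v) = 0"
      using assms u w by (simp add: sum.subset_diff[of T C] c_def sum_negf)
    moreover have "\<exists>v\<in>C. c v \<noteq> 0"
    proof -
      have "\<exists>v\<in>T. u v \<noteq> 0"
        using u(1) by (metis sum.neutral zero_neq_one)
      then show ?thesis
        using assms(3) by (auto simp: c_def)
    qed
    ultimately show False
      using assms(1,2) affine_dependent_explicit_finite by blast
  qed
  then have "affine hull T \<inter> affine hull (C - T) = {}"
    by blast
  then show ?thesis
    using assms convex_hull_subset_affine_hull by (intro face_of_convex_hulls) blast+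
qed

text \<open>Used in \<open>simplicial_Q\<close> for points of \<open>Q\<close> known only to lie in
  the affine hull of a face. A point \<open>f\<close> of \<open>F\<close> strictly between
  \<open>x\<close> and another point of \<open>F\<close> forces \<open>x\<close> into
  \<open>F\<close>.\<close>

lemma affine_hull_Int_subset_face:
  fixes F :: "'a::real_vector set"
  assumes F: "F face_of S"
  shows "affine hull F \<inter> S \<subseteq> F"
proof
  fix x assume "x \<in> affine hull F \<inter> S"
  then obtain W u where W: "finite W" "W \<noteq> {}" "W \<subseteq> F" "sum u W = 1"
      "(\<Sum>v\<in>W. u v *\<^sub>R v) = x" and xS: "x \<in> S"
    by (auto simp: affine_hull_explicit)
  \<comment> \<open>The centroid of \<open>W\<close> lies strictly between \<open>x\<close> and a point \<open>y\<close> of \<open>convex hull W\<close>.\<close>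
  define m where "m = real (card W)"
  have m: "m > 0"
    using W by (simp add: m_def card_gt_0_iff)
  define M where "M = 1 + (\<Sum>v\<in>W. \<bar>u v\<bar>)"
  have M: "M > 0"
    unfolding M_def by (smt (verit) sum_nonneg)
  have uM: "u v \<le> M" if "v \<in> W" for v
    using member_le_sum[of v W "\<lambda>v. \<bar>u v\<bar>"] that W(1) unfolding M_def by auto
  \<comment> \<open>Small enough that \<open>k * u v \<le> 1 / m\<close>, which keeps the
    coefficients of \<open>y\<close> on \<open>W\<close> nonnegative.\<close>
  define k where "k = 1 / (m * M)"
  have k: "k > 0"
    using m M by (simp add: k_def)
  define f where "f = (\<Sum>v\<in>W. (1 / m) *\<^sub>R v)"
  define y where "y = f + k *\<^sub>R (f - x)"
  have conv: "convex hull W \<subseteq> F"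
    using W(3) F by (simp add: face_of_imp_convex hull_minimal)
  have "f \<in> convex hull W"
    using W(1) m unfolding f_def convex_hull_finite[OF W(1)]
    by (auto intro!: exI[of _ "\<lambda>v. 1 / m"] simp: m_def)
  moreover have "y \<in> convex hull W"
    unfolding convex_hull_finite[OF W(1)]
  proof (intro CollectI exI conjI ballI)
    let ?c = "\<lambda>v. 1 / m + k * (1 / m - u v)"
    show "0 \<le> ?c v" if "v \<in> W" for v
    proof -
      have "k * u v \<le> k * M"
        using uM[OF that] k by simp
      also have "k * M = 1 / m"
        using M by (simp add: k_def)
      finally have "k * u v \<le> 1 / m" .
      moreover have "k / m \<ge> 0"
        using k m by simp
      ultimately show ?thesis
        by (simp add: algebra_simps)
    qed
    show "sum ?c W = 1"
      using W(4) m by (simp add: sum.distrib sum_distrib_left[symmetric] sum_subtractf m_def)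
    show "(\<Sum>v\<in>W. ?c v *\<^sub>R v) = y"
      unfolding y_def W(5)[symmetric] f_def
      by (simp add: scaleR_add_left scaleR_diff_left sum.distrib sum_subtractf scaleR_sum_right
          scaleR_diff_right right_diff_distrib)
  qed
  ultimately have fy: "f \<in> F" "y \<in> F"
    using conv by blast+
  show "x \<in> F"
  proof (cases "x = f")
    case False
    have eq: "f = (1 - 1 / (1 + k)) *\<^sub>R x + (1 / (1 + k)) *\<^sub>R y"
    proof -
      have "(1 + k) *\<^sub>R f = k *\<^sub>R x + y"
        by (simp add: y_def algebra_simps)
      moreover have "f = (1 / (1 + k)) *\<^sub>R ((1 + k) *\<^sub>R f)"
        using k by simp
      ultimately have "f = (1 / (1 + k)) *\<^sub>R (k *\<^sub>R x + y)"
        by metis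
      moreover have "1 - 1 / (1 + k) = k / (1 + k)"
        using k by (simp add: field_simps)
      ultimately show ?thesis
        by (simp add: scaleR_add_right)
    qed
    have "x \<noteq> y"
    proof
      assume "x = y"
      then have "(1 + k) *\<^sub>R (f - x) = 0"
        by (simp add: y_def algebra_simps)
      then show False
        using k False by simp
    qed
    then have "f \<in> open_segment x y"
      using eq k by (auto simp: in_segment intro!: exI[of _ "1 / (1 + k)"])
    then show ?thesis
      using F fy xS face_of_imp_subset[OF F] unfolding face_of_def by blast
  qed (use fy in simp)
qed

section \<open>Affine dimension and numbers of points\<close>

text \<open>Homogenisation \<open>b \<mapsto> (b, 1)\<close> turns affine independence into linear independence.\<close>

lemma affine_independent_card_le:
  fixes B T :: "'a::real_vector set"
  assumes B: "finite B" "\<not> affine_dependent B" and T: "finite T" "B \<subseteq> affine hull T"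
  shows "card B \<le> card T"
proof -
  define g :: "'a \<Rightarrow> 'a \<times> real" where "g x = (x, 1)" for x
  have g: "inj_on g A" for A
    by (auto simp: g_def inj_on_def)
  have sum_g: "(\<Sum>v\<in>A. c v *\<^sub>R g v) = (\<Sum>v\<in>A. c v *\<^sub>R v, sum c A)" for c and A :: "'a set"
    by (simp add: g_def sum_prod[symmetric] prod_eq_iff fst_sum snd_sum)
  have "independent (g ` B)"
  proof
    assume "dependent (g ` B)"
    then obtain c where c: "\<exists>v\<in>B. c (g v) \<noteq> 0" "(\<Sum>v\<in>B. c (g v) *\<^sub>R g v) = 0"
      using dependent_finite[of "g ` B"] B(1) by (auto simp: sum.reindex[OF g])
    then have "affine_dependent B"
      unfolding affine_dependent_explicit_finite[OF B(1)] sum_g[of "\<lambda>v. c (g v)"]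
      by (intro exI[of _ "\<lambda>v. c (g v)"]) (simp add: zero_prod_def)
    then show False using B(2) by simp
  qed
  moreover have "g ` B \<subseteq> span (g ` T)"
  proof (rule image_subsetI)
    fix b assume "b \<in> B"
    then obtain u where u: "sum u T = 1" "(\<Sum>v\<in>T. u v *\<^sub>R v) = b"
      using T affine_hull_finite[OF T(1)] by auto
    then have "g b = (\<Sum>v\<in>T. u v *\<^sub>R g v)"
      by (simp add: sum_g) (simp add: g_def)
    then show "g b \<in> span (g ` T)"
      by (simp add: span_base span_scale span_sum)
  qed
  ultimately have "card (g ` B) \<le> card (g ` T)"
    using independent_span_bound[of "g ` T" "g ` B"] T(1) by simp
  then show ?thesis
    by (simp add: card_image[OF g])
qed

text \<open>Compare \<open>V\<close> with an affine basis \<open>B\<close> of \<open>S\<close> and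
  with an independent \<open>C \<subseteq> V\<close> spanning the same hull. A vertex count thus
  decides later whether a polytope is a simplex.\<close>

lemma has_aff_dim_card:
  fixes V :: "'a::real_vector set"
  assumes "has_aff_dim S k" "finite V" "affine hull V = affine hull S"
  shows "k + 1 \<le> card V" "affine_dependent V \<longleftrightarrow> card V \<noteq> k + 1"
proof -
  obtain B where B: "affine hull B = affine hull S" "\<not> affine_dependent B" "card B = k + 1"
    using assms(1) unfolding has_aff_dim_def by blast
  \<comment> \<open>An infinite set has \<open>card\<close> 0, so a positive \<open>card\<close>
    forces finiteness.\<close>
  have fB: "finite B"
    using B(3) card.infinite by fastforce
  obtain C where C: "C \<subseteq> V" "\<not> affine_dependent C" "affine hull V = affine hull C"
    using affine_basis_exists[of V] by blast
  have fC: "finite C"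
    using C assms finite_subset by blast
  have "card B \<le> card C"
    using B C fB fC assms(3) hull_subset[of B affine]
    by (intro affine_independent_card_le) auto
  moreover have "card C < card V" if "affine_dependent V"
    using that C assms by (intro psubset_card_mono) auto
  moreover have "card V \<le> card B" if "\<not> affine_dependent V"
    using that assms B fB hull_subset[of V affine] by (intro affine_independent_card_le) auto
  moreover have "card C \<le> card V"
    using C assms card_mono by blast
  ultimately show "k + 1 \<le> card V" "affine_dependent V \<longleftrightarrow> card V \<noteq> k + 1"
    using B(3) by linarith+
qed

section \<open>Boundary complexes\<close>

lemma boundary_complex_eq:
  "boundary_complex P = {{x. x extreme_point_of P} \<inter> F | F. F face_of P \<and> F \<noteq> P}"
proof -
  have "{x. x extreme_point_of F} = {x. x extreme_point_of P} \<inter> F" if "F face_of P" for F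
    using extreme_point_of_face[OF that] by blast
  then show ?thesis
    unfolding boundary_complex_def by (metis (no_types, lifting))
qed

text \<open>Proper nonempty faces are simplices, and any set of vertices of a simplex spans a face
  of it. Transitivity gives a face of \<open>P\<close>, proper because it lies in
  \<open>F\<close>.\<close>

lemma boundary_complex_downward_closed:
  assumes P: "simplicial_polytope P" and B: "B \<in> boundary_complex P" and A: "A \<subseteq> B"
  shows "A \<in> boundary_complex P"
proof -
  obtain F where F: "F face_of P" "F \<noteq> P" "B = {x. x extreme_point_of F}"
    using B unfolding boundary_complex_def by blast
  show ?thesis
  proof (cases "F = {}")
    case True
    then show ?thesis using A B F by simp
  next
    case False
    then obtain k C where C: "\<not> affine_dependent C" "card C = k + 1" "F = convex hull C"
      using P F unfolding simplicial_polytope_def k_simplex_def by blast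
    have fC: "finite C"
      using C(2) card.infinite by fastforce
    have AC: "A \<subseteq> C"
      using A F(3) C(3) extreme_points_of_affine_independent[OF fC C(1)] by simp
    have ext: "{x. x extreme_point_of convex hull A} = A"
      using AC fC C(1) affine_dependent_subset[of A C] finite_subset[of A C]
      by (intro extreme_points_of_affine_independent) auto
    have face: "convex hull A face_of F"
      using face_of_affine_independent[OF fC C(1) AC] C(3) by simp
    then have "convex hull A face_of P"
      using F(1) face_of_trans by blast
    moreover have "convex hull A \<noteq> P"
      using face F face_of_imp_subset by blast
    ultimately show ?thesis
      unfolding boundary_complex_def using ext by blast
  qed
qed

text \<open>Each vertex is a face by itself. The bound on \<open>k\<close> excludes a one-point
  \<open>P\<close>, where that face would not be proper.\<close>

lemma Union_boundary_complex:
  assumes "has_aff_dim P k" "k \<ge> 1"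
  shows "\<Union>(boundary_complex P) = {x. x extreme_point_of P}"
proof
  show "\<Union>(boundary_complex P) \<subseteq> {x. x extreme_point_of P}"
    unfolding boundary_complex_eq by blast
  show "{x. x extreme_point_of P} \<subseteq> \<Union>(boundary_complex P)"
  proof clarify
    fix x assume x: "x extreme_point_of P"
    have "{x} \<noteq> P"
      using has_aff_dim_card(1)[OF assms(1), of "{x}"] assms(2) by auto
    moreover have "{x} face_of P"
      using x by (simp add: face_of_singleton)
    ultimately have "{y. y extreme_point_of {x}} \<in> boundary_complex P"
      unfolding boundary_complex_def by blast
    then show "x \<in> \<Union>(boundary_complex P)"
      by auto
  qed
qed

section \<open>Generic liftings\<close>

text \<open>The heights are \<open>h v = t ^ idx v\<close>: for an affine dependency \<open>c\<close>, the sum of the \<open>c v * h v\<close>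
  is a nonzero polynomial in \<open>t\<close>, so it suffices to avoid finitely many roots.\<close>

lemma generic_heights_exist:
  fixes V :: "'a::real_vector set"
  assumes V: "finite V"
  shows "\<exists>h :: 'a \<Rightarrow> real. \<forall>W\<subseteq>V. affine_dependent W \<longrightarrow>
    (\<exists>c. sum c W = 0 \<and> (\<Sum>v\<in>W. c v *\<^sub>R v) = 0 \<and> (\<Sum>v\<in>W. c v * h v) \<noteq> 0)"
proof -
  obtain idx :: "'a \<Rightarrow> nat" where idx: "inj_on idx V"
    using finite_imp_inj_to_nat_seg[OF V] by metis
  \<comment> \<open>One dependency \<open>c W\<close> is fixed for each of these finitely many sets,
    so only finitely many polynomials arise.\<close>
  define D where "D = {W. W \<subseteq> V \<and> affine_dependent W}"
  have fD: "finite D"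
    using V by (simp add: D_def)
  have "\<exists>c. sum c W = 0 \<and> (\<exists>v\<in>W. c v \<noteq> (0::real)) \<and> (\<Sum>v\<in>W. c v *\<^sub>R v) = 0"
    if "W \<in> D" for W
    using that finite_subset[OF _ V, of W] affine_dependent_explicit_finite[of W]
    unfolding D_def by blast
  then have "\<exists>c. \<forall>W\<in>D. sum (c W) W = 0 \<and> (\<exists>v\<in>W. c W v \<noteq> (0::real)) \<and>
      (\<Sum>v\<in>W. c W v *\<^sub>R v) = 0"
    by (intro bchoice) simp
  then obtain c where c: "\<And>W. W \<in> D \<Longrightarrow> sum (c W) W = 0"
      "\<And>W. W \<in> D \<Longrightarrow> \<exists>v\<in>W. c W v \<noteq> (0::real)" "\<And>W. W \<in> D \<Longrightarrow> (\<Sum>v\<in>W. c W v *\<^sub>R v) = 0"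
    by blast
  define p where "p W = (\<Sum>v\<in>W. monom (c W v) (idx v))" for W
  have p: "p W \<noteq> 0" if W: "W \<in> D" for W
  proof -
    have WV: "W \<subseteq> V"
      using W by (simp add: D_def)
    obtain w where w: "w \<in> W" "c W w \<noteq> 0"
      using c(2)[OF W] by blast
    \<comment> \<open>Injectivity of \<open>idx\<close> separates the exponents, so nothing cancels
      at \<open>idx w\<close>.\<close>
    have "coeff (p W) (idx w) = (\<Sum>v\<in>W. if v = w then c W v else 0)"
      unfolding p_def coeff_sum
      using idx WV w(1) by (intro sum.cong) (auto simp: inj_on_def)
    also have "\<dots> = c W w"
      using w(1) finite_subset[OF WV V] by simp
    finally show ?thesis
      using w(2) by auto
  qed
  have "finite (\<Union>W\<in>D. {t. poly (p W) t = 0})"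
    using fD p poly_roots_finite by blast
  then obtain t where t: "t \<notin> (\<Union>W\<in>D. {t. poly (p W) t = 0})"
    using ex_new_if_finite infinite_UNIV_char_0 by blast
  have "(\<Sum>v\<in>W. c W v * t ^ idx v) \<noteq> 0" if "W \<in> D" for W
    using t that by (auto simp: p_def poly_sum poly_monom)
  then show ?thesis
    using c(1,3) unfolding D_def by (intro exI[of _ "\<lambda>v. t ^ idx v"]) blast
qed

text \<open>Serves to index affine combinations of lifted vertices by the vertices below
  them.\<close>

lemma affine_hull_finite_image:
  assumes "finite A" "inj_on f A"
  shows "affine hull (f ` A) = {y. \<exists>u. sum u A = 1 \<and> (\<Sum>v\<in>A. u v *\<^sub>R f v) = y}"
proof -
  have "\<exists>w. sum w (f ` A) = 1 \<and> (\<Sum>x\<in>f ` A. w x *\<^sub>R x) = (\<Sum>v\<in>A. u v *\<^sub>R f v)"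
    if "sum u A = 1" for u :: "_ \<Rightarrow> real"
    using that assms by (intro exI[of _ "\<lambda>x. u (the_inv_into A f x)"])
      (simp add: sum.reindex the_inv_into_f_f)
  then show ?thesis
    using assms by (auto simp: affine_hull_finite sum.reindex)
qed

section \<open>The lifted polytope \<open>Q\<close> and its projection to \<open>P\<close>\<close>

text \<open>\<open>\<phi>\<close> is the coordinate along the new direction \<open>e\<close>, and
  \<open>P\<close> lies in its kernel. By \<open>generic\<close>, some dependency of each dependent
  \<open>W\<close> becomes a nonzero multiple of \<open>e\<close> when applied to the lifted
  points.\<close>

locale generic_lift =
  fixes P :: "'a::real_vector set" and \<phi> :: "'a \<Rightarrow> real" and e :: 'a and h :: "'a \<Rightarrow> real"
  assumes simplicial: "simplicial_polytope P"
    and linear_\<phi>: "linear \<phi>" and \<phi>_e: "\<phi> e = 1" and \<phi>_P: "\<And>x. x \<in> P \<Longrightarrow> \<phi> x = 0"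
    and generic: "\<And>W. W \<subseteq> {x. x extreme_point_of P} \<Longrightarrow> affine_dependent W \<Longrightarrow>
      \<exists>c. sum c W = 0 \<and> (\<Sum>v\<in>W. c v *\<^sub>R v) = 0 \<and> (\<Sum>v\<in>W. c v * h v) \<noteq> 0"
begin

definition V where "V = {x. x extreme_point_of P}"
definition lift where "lift v = v + h v *\<^sub>R e"
text \<open>The linear projection along \<open>e\<close> onto the kernel of \<open>\<phi>\<close>,
  which undoes \<open>lift\<close> on \<open>V\<close>.\<close>

definition proj where "proj x = x - \<phi> x *\<^sub>R e"
definition Q where "Q = convex hull (lift ` V)"

lemma finite_V: "finite V" and P_eq: "P = convex hull V"
  using polytope_eq_convex_hull_extreme_points[of P] simplicial
  by (simp_all add: V_def simplicial_polytope_def)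

lemma affine_hull_V: "affine hull V = affine hull P"
  using affine_hull_convex_hull[of V] by (simp only: P_eq[symmetric])

lemma V_subset: "V \<subseteq> P"
  unfolding V_def extreme_point_of_def by blast

lemma linear_proj: "linear proj"
  by (rule linearI)
    (simp_all add: proj_def linear_add[OF linear_\<phi>] linear_scale[OF linear_\<phi>] algebra_simps)

lemma proj_lift [simp]: "v \<in> V \<Longrightarrow> proj (lift v) = v"
  using V_subset \<phi>_P[of v]
  by (auto simp: proj_def lift_def linear_add[OF linear_\<phi>] linear_scale[OF linear_\<phi>] \<phi>_e)

lemma inj_on_lift: "W \<subseteq> V \<Longrightarrow> inj_on lift W"
  by (metis inj_on_inverseI proj_lift subsetD)

lemma proj_image_lift: "W \<subseteq> V \<Longrightarrow> proj ` lift ` W = W"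
  by (force simp: image_image)

lemma proj_Q: "proj ` Q = P"
  unfolding Q_def using convex_hull_linear_image[OF linear_proj, of "lift ` V"]
  by (simp add: proj_image_lift P_eq[symmetric])

lemma convex_Q: "convex Q"
  by (simp add: Q_def)

lemma lift_in_Q: "v \<in> V \<Longrightarrow> lift v \<in> Q"
  by (simp add: Q_def hull_inc)

text \<open>A segment in \<open>Q\<close> projects to a segment in \<open>P\<close>, where the face
  property of \<open>G\<close> applies, or collapses to the point \<open>proj x\<close>, which is
  already in \<open>G\<close>.\<close>

lemma face_of_vimage:
  assumes G: "G face_of P"
  shows "Q \<inter> proj -` G face_of Q"
  unfolding face_of_def
proof (intro conjI ballI impI)
  show "convex (Q \<inter> proj -` G)"
    using G convex_Q by (simp add: convex_Int convex_linear_vimage face_of_imp_convex linear_proj)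
  fix a b x assume ab: "a \<in> Q" "b \<in> Q" and x: "x \<in> Q \<inter> proj -` G" "x \<in> open_segment a b"
  obtain u where u: "0 < u" "u < 1" "x = (1 - u) *\<^sub>R a + u *\<^sub>R b"
    using x(2) by (auto simp: in_segment)
  have px: "proj x = (1 - u) *\<^sub>R proj a + u *\<^sub>R proj b"
    using linear_proj u(3) by (simp add: linear_add linear_scale)
  have "proj a \<in> G \<and> proj b \<in> G"
  proof (cases "proj a = proj b")
    case True
    then show ?thesis
      using px x(1) by (simp add: scaleR_left_distrib[symmetric])
  next
    case False
    then have "proj x \<in> open_segment (proj a) (proj b)"
      using px u by (auto simp: in_segment)
    then show ?thesis
      using G ab x(1) proj_Q unfolding face_of_def by blast
  qed
  then show "a \<in> Q \<inter> proj -` G" "b \<in> Q \<inter> proj -` G"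
    using ab by auto
qed auto

text \<open>The fibre of \<open>proj\<close> in \<open>Q\<close> over a vertex \<open>v\<close> is a
  face that meets the generators only in \<open>lift v\<close>, hence is that single point.\<close>

lemma extreme_points_Q: "{x. x extreme_point_of Q} = lift ` V"
proof
  show "{x. x extreme_point_of Q} \<subseteq> lift ` V"
    unfolding Q_def using extreme_point_of_convex_hull by blast
  show "lift ` V \<subseteq> {x. x extreme_point_of Q}"
  proof clarify
    fix v assume v: "v \<in> V"
    let ?F = "Q \<inter> proj -` {v}"
    have face: "?F face_of Q"
      using v face_of_vimage[of "{v}"] by (simp add: V_def face_of_singleton)
    have "lift ` V \<inter> ?F = {lift v}"
      using v lift_in_Q by auto
    then have "?F = {lift v}"
      using face_of_convex_hull_finite[of "lift ` V" ?F] face finite_V by (simp add: Q_def)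
    then show "lift v extreme_point_of Q"
      using face by (simp add: face_of_singleton)
  qed
qed

text \<open>The required face of \<open>Q\<close> is the preimage of the face \<open>G\<close> that
  carries \<open>A\<close>; it is proper because \<open>proj\<close> maps \<open>Q\<close> onto
  \<open>P\<close>.\<close>

lemma lift_boundary_complex:
  assumes "A \<in> boundary_complex P"
  shows "lift ` A \<in> boundary_complex Q"
proof -
  obtain G where G: "G face_of P" "G \<noteq> P" "A = V \<inter> G"
    using assms unfolding boundary_complex_eq V_def by blast
  have "Q \<inter> proj -` G \<noteq> Q"
  proof
    assume "Q \<inter> proj -` G = Q"
    then have "proj ` Q \<subseteq> G" by blast
    then show False
      using G(2) face_of_imp_subset[OF G(1)] by (simp add: proj_Q)
  qed
  moreover have "lift ` A = lift ` V \<inter> (Q \<inter> proj -` G)"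
    unfolding G(3) using lift_in_Q by (auto intro!: imageI)
  ultimately show ?thesis
    unfolding boundary_complex_eq extreme_points_Q using face_of_vimage[OF G(1)] by blast
qed

text \<open>A generic dependency \<open>c\<close> of \<open>W\<close>, applied to the lifted points,
  gives \<open>s *\<^sub>R e\<close> with \<open>s\<close> nonzero. Adding \<open>t / s\<close>
  times it to an affine combination raises the point by \<open>t\<close> and leaves the total weight
  1.\<close>

lemma affine_hull_lift_vertical:
  assumes W: "W \<subseteq> V" "affine_dependent W" and y: "y \<in> affine hull (lift ` W)"
  shows "y + t *\<^sub>R e \<in> affine hull (lift ` W)"
proof -
  have fW: "finite W"
    using W finite_V finite_subset by blast
  obtain c where c: "sum c W = 0" "(\<Sum>v\<in>W. c v *\<^sub>R v) = 0" "(\<Sum>v\<in>W. c v * h v) \<noteq> 0"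
    using generic W unfolding V_def by blast
  define s where "s = (\<Sum>v\<in>W. c v * h v)"
  have se: "(\<Sum>v\<in>W. c v *\<^sub>R lift v) = s *\<^sub>R e"
    using c(2) by (simp add: lift_def s_def scaleR_add_right sum.distrib scaleR_sum_left)
  obtain u where u: "sum u W = 1" "(\<Sum>v\<in>W. u v *\<^sub>R lift v) = y"
    using y affine_hull_finite_image[OF fW inj_on_lift[OF W(1)]] by auto
  let ?w = "\<lambda>v. u v + (t / s) * c v"
  have "sum ?w W = sum u W + (t / s) * sum c W"
    by (simp only: sum.distrib sum_distrib_left)
  then have "sum ?w W = 1"
    using c(1) u(1) by simp
  moreover have "(\<Sum>v\<in>W. ?w v *\<^sub>R lift v) = y + (t / s) *\<^sub>R (\<Sum>v\<in>W. c v *\<^sub>R lift v)"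
    using u(2) by (simp add: scaleR_add_left sum.distrib scaleR_sum_right)
  then have "(\<Sum>v\<in>W. ?w v *\<^sub>R lift v) = y + t *\<^sub>R e"
    using c(3) by (simp add: se s_def[symmetric])
  ultimately show ?thesis
    unfolding affine_hull_finite_image[OF fW inj_on_lift[OF W(1)]] by blast
qed

text \<open>Applying \<open>proj\<close> to a dependency of the lifted points keeps its
  coefficients.\<close>

lemma affine_dependent_lift:
  assumes W: "W \<subseteq> V" and dep: "affine_dependent (lift ` W)"
  shows "affine_dependent W"
proof -
  have fW: "finite W"
    using W finite_V finite_subset by blast
  obtain c where c: "sum c (lift ` W) = 0" "\<exists>x\<in>lift ` W. c x \<noteq> 0"
      "(\<Sum>x\<in>lift ` W. c x *\<^sub>R x) = 0"
    using dep affine_dependent_explicit_finite[of "lift ` W"] fW by auto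
  have "(\<Sum>v\<in>W. c (lift v) *\<^sub>R v) = (\<Sum>v\<in>W. c (lift v) *\<^sub>R proj (lift v))"
    using W by (intro sum.cong) auto
  also have "\<dots> = proj (\<Sum>v\<in>W. c (lift v) *\<^sub>R lift v)"
    using linear_proj by (simp add: linear_sum linear_scale)
  also have "\<dots> = 0"
    using c(3) linear_proj by (simp add: sum.reindex[OF inj_on_lift[OF W]] linear_0)
  finally show ?thesis
    using c(1,2) unfolding affine_dependent_explicit_finite[OF fW]
    by (intro exI[of _ "\<lambda>v. c (lift v)"]) (simp add: sum.reindex[OF inj_on_lift[OF W]])
qed

text \<open>If the vertices of a face \<open>F\<close> were dependent, then by genericity \<open>F\<close> would contain every point
  of \<open>Q\<close> above \<open>proj ` F\<close>, which would make \<open>proj ` F\<close> a face of \<open>P\<close> with dependent vertices.\<close>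

lemma simplicial_Q: "simplicial_polytope Q"
  unfolding simplicial_polytope_def
proof (intro conjI allI impI)
  show "polytope Q"
    unfolding polytope_def Q_def using finite_V by blast
  fix F assume F: "F face_of Q \<and> F \<noteq> {} \<and> F \<noteq> Q"
  define W where "W = {v \<in> V. lift v \<in> F}"
  have W: "W \<subseteq> V" "finite W"
    using finite_V by (auto simp: W_def)
  have "lift ` V \<inter> F = lift ` W"
    by (auto simp: W_def)
  then have F_eq: "F = convex hull (lift ` W)"
    using face_of_convex_hull_finite[of "lift ` V" F] F finite_V by (simp add: Q_def)
  have "\<not> affine_dependent (lift ` W)"
  proof
    assume "affine_dependent (lift ` W)"
    then have dep: "affine_dependent W"
      using W affine_dependent_lift by blast
    \<comment> \<open>\<open>z\<close> differs from a point \<open>f\<close> of \<open>F\<close> by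
      a multiple of \<open>e\<close>, so it stays in the affine hull of \<open>F\<close>; a face
      contains every point of \<open>Q\<close> in its affine hull.\<close>
    have key: "z \<in> F" if z: "z \<in> Q" "proj z \<in> proj ` F" for z
    proof -
      obtain f where f: "f \<in> F" "proj z = proj f"
        using z(2) by blast
      then have "z = f + (\<phi> z - \<phi> f) *\<^sub>R e"
        by (simp add: proj_def algebra_simps)
      moreover have "f \<in> affine hull (lift ` W)"
        using f F_eq convex_hull_subset_affine_hull by blast
      ultimately have "z \<in> affine hull F"
        using affine_hull_lift_vertical[OF W(1) dep] unfolding F_eq affine_hull_convex_hull by metis
      then show ?thesis
        using affine_hull_Int_subset_face z(1) F by blast
    qed
    have FQ: "F \<subseteq> Q"
      using F face_of_imp_subset by blast
    \<comment> \<open>A segment of \<open>P\<close> through a projected point is lifted to a segment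
      of \<open>Q\<close>. By \<open>key\<close> its point \<open>x'\<close> over \<open>x\<close>
      is in \<open>F\<close>, hence so are its ends.\<close>
    have face: "proj ` F face_of P"
      unfolding face_of_def
    proof (intro conjI ballI impI)
      show "proj ` F \<subseteq> P"
        using FQ proj_Q by blast
      show "convex (proj ` F)"
        using F face_of_imp_convex linear_proj by (simp add: convex_linear_image F_eq)
      fix a b x assume ab: "a \<in> P" "b \<in> P" and x: "x \<in> proj ` F" "x \<in> open_segment a b"
      have "a \<in> proj ` Q" "b \<in> proj ` Q"
        using ab proj_Q by simp_all
      then obtain a' b' where ab': "a' \<in> Q" "b' \<in> Q" "proj a' = a" "proj b' = b"
        by auto
      obtain u where u: "0 < u" "u < 1" "x = (1 - u) *\<^sub>R a + u *\<^sub>R b" and ne: "a \<noteq> b"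
        using x(2) by (auto simp: in_segment)
      define x' where "x' = (1 - u) *\<^sub>R a' + u *\<^sub>R b'"
      have "x' \<in> Q"
        unfolding x'_def using convex_Q ab' u by (simp add: convex_alt)
      moreover have "proj x' = x"
        using linear_proj u(3) ab' by (simp add: x'_def linear_add linear_scale)
      ultimately have "x' \<in> F"
        using key x(1) by simp
      moreover have "x' \<in> open_segment a' b'"
        using u ne ab' by (auto simp: in_segment x'_def)
      ultimately have "a' \<in> F" "b' \<in> F"
        using F ab' face_ofD by blast+
      then show "a \<in> proj ` F" "b \<in> proj ` F"
        using ab' by blast+
    qed
    \<comment> \<open>Otherwise \<open>key\<close> would give \<open>Q \<subseteq> F\<close>. The
      projected face is therefore a simplex, and the dependent \<open>W\<close> consists of vertices
      of it.\<close>
    have "proj ` F \<noteq> P"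
      using key proj_Q F FQ by blast
    then obtain k C where C: "\<not> affine_dependent C" "card C = k + 1" "proj ` F = convex hull C"
      using face F simplicial unfolding simplicial_polytope_def k_simplex_def by (metis image_is_empty)
    have "finite C"
      using C(2) card.infinite by fastforce
    then have "{x. x extreme_point_of proj ` F} = C"
      using C extreme_points_of_affine_independent by simp
    moreover have "W \<subseteq> {x. x extreme_point_of proj ` F}"
    proof
      fix v assume "v \<in> W"
      then have "v \<in> V" "v \<in> proj ` F"
        by (auto simp: W_def) (metis imageI proj_lift)
      then show "v \<in> {x. x extreme_point_of proj ` F}"
        using extreme_point_of_face[OF face] by (simp add: V_def)
    qed
    ultimately show False
      using dep C(1) affine_dependent_subset by blast
  qed
  \<comment> \<open>The dimension is one less than the number of vertices; the subtraction is exact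
    because \<open>W\<close> is nonempty.\<close>
  moreover have "card (lift ` W) = card (lift ` W) - 1 + 1"
  proof -
    have "W \<noteq> {}"
      using F F_eq by auto
    then show ?thesis
      using W(2) by (simp add: card_gt_0_iff Suc_leI)
  qed
  ultimately show "\<exists>k. k_simplex k F"
    unfolding k_simplex_def using F_eq by blast
qed

text \<open>An affine basis \<open>B\<close> of \<open>P\<close> together with one point
  \<open>b + e\<close> off its hull is an affine basis for \<open>Q\<close>. Dependence of
  \<open>V\<close> is what puts the vertical direction into the affine hull of
  \<open>Q\<close>.\<close>

lemma has_aff_dim_Q:
  assumes dim: "has_aff_dim P k" and dep: "affine_dependent V"
  shows "has_aff_dim Q (k + 1)"
proof -
  obtain B where B: "affine hull B = affine hull P" "\<not> affine_dependent B" "card B = k + 1"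
    using dim unfolding has_aff_dim_def by blast
  have fB: "finite B" and "B \<noteq> {}"
    using B(3) card.infinite by fastforce+
  then obtain b where b: "b \<in> B" by blast
  have "subspace {x. \<phi> x = 0}"
    using linear_\<phi> by (simp add: linear_subspace_kernel)
  then have "affine hull P \<subseteq> {x. \<phi> x = 0}"
    using \<phi>_P by (intro hull_minimal subspace_imp_affine) auto
  then have \<phi>_B: "\<phi> x = 0" if "x \<in> B" for x
    using that B(1) hull_inc[of x B affine] by auto
  define a where "a = b + e"
  have \<phi>_a: "\<phi> a = 1"
    using \<phi>_B[OF b] \<phi>_e linear_\<phi> by (simp add: a_def linear_add)
  then have a: "a \<notin> B"
    using \<phi>_B by auto
  have "\<not> affine_dependent (insert a B)"
  proof
    assume "affine_dependent (insert a B)"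
    then obtain c where c: "sum c (insert a B) = 0" "\<exists>v\<in>insert a B. c v \<noteq> 0"
        "(\<Sum>v\<in>insert a B. c v *\<^sub>R v) = 0"
      using affine_dependent_explicit_finite[of "insert a B"] fB by auto
    \<comment> \<open>\<open>\<phi>\<close> is 0 on \<open>B\<close> and 1 at \<open>a\<close>, so
      it isolates the coefficient of \<open>a\<close>.\<close>
    have "0 = \<phi> (\<Sum>v\<in>insert a B. c v *\<^sub>R v)"
      using c(3) linear_\<phi> by (simp add: linear_0)
    also have "\<dots> = (\<Sum>v\<in>insert a B. c v * \<phi> v)"
      using linear_\<phi> by (simp add: linear_sum linear_scale)
    also have "\<dots> = c a"
      using fB a \<phi>_a \<phi>_B by simp
    finally have "c a = 0" by simp
    then have "affine_dependent B"
      using c fB a unfolding affine_dependent_explicit_finite[OF fB] by auto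
    then show False using B(2) by simp
  qed
  moreover have "card (insert a B) = (k + 1) + 1"
    using fB a B(3) by simp
  moreover have "affine hull (insert a B) = affine hull Q"
  proof
    have Q: "affine hull Q = affine hull (lift ` V)"
      by (simp add: Q_def affine_hull_convex_hull)
    \<comment> \<open>\<open>x\<close> is the projection of a point \<open>y\<close> of the hull,
      whose height can be changed at will because \<open>V\<close> is dependent.\<close>
    have vert: "x + t *\<^sub>R e \<in> affine hull Q" if "x \<in> B" for x t
    proof -
      have "x \<in> affine hull (proj ` lift ` V)"
        using that B(1) hull_inc[of x B affine]
        by (simp add: proj_image_lift affine_hull_V)
      then obtain y where y: "y \<in> affine hull (lift ` V)" "x = proj y"
        unfolding affine_hull_linear_image[OF linear_proj] by blast
      have "x + t *\<^sub>R e = y + (t - \<phi> y) *\<^sub>R e"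
        by (simp add: y(2) proj_def algebra_simps)
      then show ?thesis
        using affine_hull_lift_vertical[OF _ dep y(1)] by (simp add: Q)
    qed
    have "insert a B \<subseteq> affine hull Q"
      using vert[of _ 0] vert[OF b, of 1] by (auto simp: a_def)
    then show "affine hull (insert a B) \<subseteq> affine hull Q"
      by (simp add: hull_minimal)
    have "lift v \<in> affine hull (insert a B)" if v: "v \<in> V" for v
    proof -
      have "v \<in> affine hull B"
        unfolding B(1) using v V_subset by (auto intro: hull_inc)
      then have "v \<in> affine hull (insert a B)"
        by (meson hull_mono subsetD subset_insertI)
      moreover have "a \<in> affine hull (insert a B)" "b \<in> affine hull (insert a B)"
        using b by (simp_all add: hull_inc)
      \<comment> \<open>Since \<open>a - b\<close> is \<open>e\<close>, this point is
        \<open>lift v\<close>.\<close>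
      ultimately have "v + h v *\<^sub>R (a - b) \<in> affine hull (insert a B)"
        by (intro mem_affine_3_minus affine_affine_hull)
      then show ?thesis
        by (simp add: a_def lift_def)
    qed
    then show "affine hull Q \<subseteq> affine hull (insert a B)"
      unfolding Q by (intro hull_minimal affine_affine_hull) auto
  qed
  ultimately show ?thesis
    unfolding has_aff_dim_def by blast
qed

end

section \<open>Polytopal spheres\<close>

lemma lookup_scaleR_real_inf:
  fixes p :: real_inf
  shows "Poly_Mapping.lookup (r *\<^sub>R p) i = r * Poly_Mapping.lookup p i"
proof -
  have "finite {i. r * Poly_Mapping.lookup p i \<noteq> 0}"
    by (rule finite_subset[OF _ finite_keys[of p]]) (auto simp: in_keys_iff)
  then show ?thesis by (simp add: scaleR_poly_mapping_def)
qed

text \<open>The finitely many vertices have finite supports, so some coordinate \<open>N\<close>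
  vanishes on all of \<open>P\<close>; it provides both \<open>\<phi>\<close> and
  \<open>e\<close>.\<close>

lemma generic_lift_exists:
  fixes P :: "real_inf set"
  assumes P: "simplicial_polytope P"
  shows "\<exists>\<phi> e h. generic_lift P \<phi> e h"
proof -
  let ?V = "{x. x extreme_point_of P}"
  have V: "finite ?V" "P = convex hull ?V"
    using P polytope_eq_convex_hull_extreme_points unfolding simplicial_polytope_def by blast+
  have "finite (\<Union>v\<in>?V. Poly_Mapping.keys v)"
    using V(1) by simp
  then obtain N where N: "N \<notin> (\<Union>v\<in>?V. Poly_Mapping.keys v)"
    using ex_new_if_finite infinite_UNIV_nat by blast
  define \<phi> :: "real_inf \<Rightarrow> real" where "\<phi> x = Poly_Mapping.lookup x N" for x
  have lin: "linear \<phi>"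
    by (rule linearI) (simp_all add: \<phi>_def lookup_add lookup_scaleR_real_inf)
  have "?V \<subseteq> {x. \<phi> x = 0}"
    using N by (auto simp: \<phi>_def in_keys_iff)
  then have "convex hull ?V \<subseteq> {x. \<phi> x = 0}"
    using subspace_imp_convex[OF linear_subspace_kernel[OF lin]] by (rule hull_minimal)
  then have "\<phi> x = 0" if "x \<in> P" for x
    using that V(2) by blast
  moreover have "\<phi> (Poly_Mapping.single N 1) = 1"
    by (simp add: \<phi>_def)
  moreover obtain h where "\<forall>W\<subseteq>?V. affine_dependent W \<longrightarrow>
    (\<exists>c. sum c W = 0 \<and> (\<Sum>v\<in>W. c v *\<^sub>R v) = 0 \<and> (\<Sum>v\<in>W. c v * h v) \<noteq> 0)"
    using generic_heights_exist[OF V(1)] by blast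
  ultimately have "generic_lift P \<phi> (Poly_Mapping.single N 1) h"
    using P lin by (simp add: generic_lift_def)
  then show ?thesis by blast
qed

section \<open>Vertex counts, one extension step and its iteration\<close>

lemma polytopal_sphereE:
  assumes "polytopal_sphere k K"
  obtains P :: "real_inf set" and f where "simplicial_polytope P" "has_aff_dim P (k + 1)"
    "bij_betw f (\<Union>K) {x. x extreme_point_of P}" "boundary_complex P = image f ` K"
    "finite {x. x extreme_point_of P}" "P = convex hull {x. x extreme_point_of P}"
proof -
  obtain P :: "real_inf set" and f where P: "simplicial_polytope P" "has_aff_dim P (k + 1)"
    "bij_betw f (\<Union>K) (\<Union>(boundary_complex P))" "boundary_complex P = image f ` K"
    using assms unfolding polytopal_sphere_def isomorphic_complexes_def by blast
  moreover have "\<Union>(boundary_complex P) = {x. x extreme_point_of P}"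
    using P(2) by (intro Union_boundary_complex) auto
  ultimately show thesis
    using that polytope_eq_convex_hull_extreme_points[of P]
    unfolding simplicial_polytope_def by auto
qed

text \<open>The vertices of \<open>P\<close> span an affine hull of dimension \<open>k + 1\<close>;
  if there are only \<open>k + 2\<close> of them, they are independent and \<open>P\<close> is a
  simplex.\<close>

lemma polytopal_sphere_card:
  assumes K: "polytopal_sphere k K"
  shows "k + 2 \<le> card (\<Union>K)" "card (\<Union>K) = k + 2 \<Longrightarrow> standard_sphere k K"
proof -
  obtain P :: "real_inf set" and f where P: "simplicial_polytope P" "has_aff_dim P (k + 1)"
    "bij_betw f (\<Union>K) {x. x extreme_point_of P}" "boundary_complex P = image f ` K"
    and V: "finite {x. x extreme_point_of P}" "P = convex hull {x. x extreme_point_of P}"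
    using polytopal_sphereE[OF K] .
  let ?V = "{x. x extreme_point_of P}"
  have hull: "affine hull ?V = affine hull P"
    using V(2) affine_hull_convex_hull by metis
  have card: "card (\<Union>K) = card ?V"
    using P(3) bij_betw_same_card by blast
  show "k + 2 \<le> card (\<Union>K)"
    using has_aff_dim_card(1)[OF P(2) V(1) hull] card by simp
  assume "card (\<Union>K) = k + 2"
  then have "k_simplex (k + 1) P"
    using has_aff_dim_card(2)[OF P(2) V(1) hull] card V(2) unfolding k_simplex_def by auto
  moreover have "isomorphic_complexes K (boundary_complex P)"
    using P unfolding isomorphic_complexes_def by (metis Union_boundary_complex le_add2)
  ultimately show "standard_sphere k K"
    using K unfolding standard_sphere_def polytopal_sphere_def by blast
qed

text \<open>More than \<open>k + 2\<close> vertices are affinely dependent, so the lifted polytope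
  \<open>Q\<close> gains a dimension while keeping the number of vertices.\<close>

lemma polytopal_sphere_extend:
  assumes K: "polytopal_sphere k K" and n: "card (\<Union>K) > k + 2"
  shows "\<exists>L. polytopal_sphere (k + 1) L \<and> K \<subseteq> L \<and> \<Union>L = \<Union>K"
proof -
  obtain P :: "real_inf set" and f where P: "simplicial_polytope P" "has_aff_dim P (k + 1)"
    "bij_betw f (\<Union>K) {x. x extreme_point_of P}" "boundary_complex P = image f ` K"
    and V: "finite {x. x extreme_point_of P}" "P = convex hull {x. x extreme_point_of P}"
    using polytopal_sphereE[OF K] .
  obtain \<phi> e h where "generic_lift P \<phi> e h"
    using generic_lift_exists[OF P(1)] by blast
  then interpret generic_lift P \<phi> e h .
  have "card (\<Union>K) = card V"
    using P(3) bij_betw_same_card unfolding V_def by blast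
  then have "affine_dependent V"
    using has_aff_dim_card(2)[OF P(2) finite_V affine_hull_V] n by simp
  then have dimQ: "has_aff_dim Q (k + 1 + 1)"
    using has_aff_dim_Q P(2) by blast
  define g where "g = lift \<circ> f"
  have bij: "bij_betw g (\<Union>K) (lift ` V)"
    unfolding g_def using P(3) inj_on_lift[of V]
    by (intro bij_betw_trans[of f _ V]) (auto simp: V_def bij_betw_def)
  have UQ: "\<Union>(boundary_complex Q) = lift ` V"
    using Union_boundary_complex[OF dimQ] extreme_points_Q by simp
  \<comment> \<open>The boundary complex of \<open>Q\<close> is pulled back to the vertices of
    \<open>K\<close>, so that \<open>K\<close> is contained in \<open>L\<close> itself, not just
    isomorphic to a subcomplex.\<close>
  define L where "L = {A. A \<subseteq> \<Union>K \<and> g ` A \<in> boundary_complex Q}"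
  have img: "image g ` L = boundary_complex Q"
  proof
    show "boundary_complex Q \<subseteq> image g ` L"
    proof
      fix B assume B: "B \<in> boundary_complex Q"
      then have "B \<subseteq> g ` \<Union>K"
        using Union_upper[OF B] UQ bij by (simp add: bij_betw_def)
      then obtain A where "A \<subseteq> \<Union>K" "B = g ` A"
        by (meson subset_imageE)
      then show "B \<in> image g ` L"
        using B unfolding L_def by blast
    qed
  qed (auto simp: L_def)
  have UL: "\<Union>L = \<Union>K"
  proof
    show "\<Union>L \<subseteq> \<Union>K"
      unfolding L_def by blast
    have "g ` \<Union>L = g ` \<Union>K"
      using img UQ bij by (simp add: image_Union bij_betw_def)
    then show "\<Union>K \<subseteq> \<Union>L"
      using \<open>\<Union>L \<subseteq> \<Union>K\<close> bij unfolding bij_betw_def by (metis inj_on_image_eq_iff order_refl)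
  qed
  have fK: "finite (\<Union>K)"
    using n card.infinite by fastforce
  have sub: "K \<subseteq> L"
  proof
    fix A assume A: "A \<in> K"
    then have "lift ` f ` A \<in> boundary_complex Q"
      using P(4) lift_boundary_complex by simp
    then show "A \<in> L"
      using A by (auto simp: L_def g_def image_comp)
  qed
  have "simplicial_complex L"
    unfolding simplicial_complex_def
  proof (intro conjI ballI allI impI)
    show "finite L"
      by (rule finite_subset[of _ "Pow (\<Union>K)"]) (use fK in \<open>auto simp: L_def\<close>)
    show "finite F" if "F \<in> L" for F
      using that fK finite_subset unfolding L_def by blast
    have ex: "K \<noteq> {}"
      using n by auto
    show down: "G \<in> L" if "F \<in> L" "G \<subseteq> F" for F G
      using that boundary_complex_downward_closed[OF simplicial_Q, of "g ` F" "g ` G"]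
      unfolding L_def by blast
    show "{} \<in> L"
      using ex sub down by blast
  qed
  moreover have "isomorphic_complexes L (boundary_complex Q)"
    unfolding isomorphic_complexes_def UL UQ using bij img[symmetric] by (intro exI[of _ g] conjI)
  ultimately have "polytopal_sphere (k + 1) L"
    unfolding polytopal_sphere_def using simplicial_Q dimQ by blast
  then show ?thesis
    using UL sub by blast
qed

text \<open>\<open>m\<close> is the excess of the vertex count over that of a simplex boundary. Each
  extension raises the dimension by one on the same vertices, hence lowers \<open>m\<close> by
  one.\<close>

lemma polytopal_sphere_chain:
  assumes "polytopal_sphere k K" "card (\<Union>K) = k + 2 + m"
  shows "\<exists>Y. Y k = K \<and>
    (\<forall>j. k \<le> j \<and> j \<le> k + m \<longrightarrow> polytopal_sphere j (Y j) \<and> \<Union>(Y j) = \<Union>K) \<and>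
    (\<forall>j. k \<le> j \<and> j < k + m \<longrightarrow> Y j \<subseteq> Y (j + 1)) \<and> standard_sphere (k + m) (Y (k + m))"
  using assms
proof (induction m arbitrary: k K)
  case 0
  then have "standard_sphere k K"
    using polytopal_sphere_card(2)[of k K] by simp
  moreover have "polytopal_sphere j K" if "k \<le> j \<and> j \<le> k + 0" for j
  proof -
    have "j = k" using that by simp
    then show ?thesis using 0 by simp
  qed
  ultimately show ?case
    by (intro exI[of _ "\<lambda>_. K"]) simp
next
  case (Suc m)
  obtain L where L: "polytopal_sphere (k + 1) L" "K \<subseteq> L" "\<Union>L = \<Union>K"
    using polytopal_sphere_extend[OF Suc.prems(1)] Suc.prems(2) by auto
  obtain Y where Y: "Y (k + 1) = L"
    "\<And>j. k + 1 \<le> j \<Longrightarrow> j \<le> k + 1 + m \<Longrightarrow> polytopal_sphere j (Y j) \<and> \<Union>(Y j) = \<Union>L"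
    "\<And>j. k + 1 \<le> j \<Longrightarrow> j < k + 1 + m \<Longrightarrow> Y j \<subseteq> Y (j + 1)"
    "standard_sphere (k + 1 + m) (Y (k + 1 + m))"
    using Suc.IH[OF L(1)] Suc.prems(2) L(3) by auto
  show ?case
  \<comment> \<open>The sequence for \<open>L\<close> is constrained only from \<open>k + 1\<close>
    on, so its value at \<open>k\<close> may be overwritten.\<close>
  proof (intro exI[of _ "Y(k := K)"] conjI allI impI)
    fix j
    show "polytopal_sphere j ((Y(k := K)) j)" "\<Union>((Y(k := K)) j) = \<Union>K"
      if "k \<le> j \<and> j \<le> k + Suc m"
      using that Y(2)[of j] L(3) Suc.prems(1) by auto
    show "(Y(k := K)) j \<subseteq> (Y(k := K)) (j + 1)" if "k \<le> j \<and> j < k + Suc m"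
      using that Y(1) Y(3)[of j] L(2) by auto
  qed (use Y(4) in auto)
qed

theorem corollary2:
  fixes d n :: nat and X :: "'v set set"
  assumes "d \<ge> 1"
    and "polytopal_sphere (d - 1) X"
    and "card (\<Union>X) = n"
  shows "d + 1 \<le> n \<and>
    (\<exists>Y :: nat \<Rightarrow> 'v set set.
       Y (d - 1) = X \<and>
       (\<forall>k. d - 1 \<le> k \<and> k \<le> n - 2 \<longrightarrow> polytopal_sphere k (Y k) \<and> card (\<Union>(Y k)) = n) \<and>
       (\<forall>k. d - 1 \<le> k \<and> k < n - 2 \<longrightarrow> Y k \<subseteq> Y (k + 1)) \<and>
       standard_sphere (n - 2) (Y (n - 2)) \<and> \<Union>(Y (n - 2)) = \<Union>X)"
proof -
  have le: "d + 1 \<le> n"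
    using polytopal_sphere_card(1)[OF assms(2)] assms(1,3) by simp
  \<comment> \<open>The truncated subtractions are exact because \<open>1 \<le> d\<close> and
    \<open>d + 1 \<le> n\<close>; \<open>n - (d + 1)\<close> is the number of extension
    steps.\<close>
  have dim: "d - 1 + (n - (d + 1)) = n - 2"
    using le assms(1) by simp
  have "card (\<Union>X) = d - 1 + 2 + (n - (d + 1))"
    using le assms(1,3) by simp
  from polytopal_sphere_chain[OF assms(2) this]
  have "\<exists>Y. Y (d - 1) = X \<and>
      (\<forall>k. d - 1 \<le> k \<and> k \<le> n - 2 \<longrightarrow> polytopal_sphere k (Y k) \<and> \<Union>(Y k) = \<Union>X) \<and>
      (\<forall>k. d - 1 \<le> k \<and> k < n - 2 \<longrightarrow> Y k \<subseteq> Y (k + 1)) \<and>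
      standard_sphere (n - 2) (Y (n - 2))"
    unfolding dim .
  then obtain Y where Y: "Y (d - 1) = X"
    "\<forall>k. d - 1 \<le> k \<and> k \<le> n - 2 \<longrightarrow> polytopal_sphere k (Y k) \<and> \<Union>(Y k) = \<Union>X"
    "\<forall>k. d - 1 \<le> k \<and> k < n - 2 \<longrightarrow> Y k \<subseteq> Y (k + 1)"
    "standard_sphere (n - 2) (Y (n - 2))"
    by (elim exE conjE)
  have "d - 1 \<le> n - 2"
    using dim by simp
  then have U: "\<Union>(Y (n - 2)) = \<Union>X"
    using Y(2) by simp
  show ?thesis
  proof (intro conjI exI[of _ Y])
    show "\<forall>k. d - 1 \<le> k \<and> k \<le> n - 2 \<longrightarrow> polytopal_sphere k (Y k) \<and> card (\<Union>(Y k)) = n"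
      using Y(2) assms(3) by simp
  qed (fact le Y U)+
qed

end
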